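(* Let $r,M,k$ be integers with $0<r\le M/2$ and $k=\lfloor M/2\rfloor$, and let $n\ge 0$. Let $A_n(M,r)$ be the set of partitions of $n$ all of whose successive ranks lie in the interval $[-r+2,\,M-r-2]$. Let $C_n(M,r)$ be the set of $(k-1)$-color partitions $(\alpha,c_\alpha)$ of $n$, $\alpha=(\alpha_1,\dots,\alpha_l)$, satisfying: (i) for $1\le i\le l$: $\alpha_i>|2c_\alpha(i)-r+1|$ if $\alpha_i\equiv r\pmod 2$, and $\alpha_i>|2c_\alpha(i)-r|$ otherwise; (ii) for $1\le i<l$: $\alpha_i-\alpha_{i+1}\ge 2+|2(c_\alpha(i)-c_\alpha(i+1))|$ if $\alpha_i\equiv\alpha_{i+1}\pmod 2$; $\alpha_i-\alpha_{i+1}\ge 2+|2(c_\alpha(i)-c_\alpha(i+1))-1|$ if $\alpha_i\not\equiv\alpha_{i+1}\equiv r\pmod 2$; $\alpha_i-\alpha_{i+1}\ge 2+|2(c_\alpha(i)-c_\alpha(i+1))+1|$ if $\alpha_{i+1}\not\equiv\alpha_i\equiv r\pmod 2$; (iii) if $M$ is even, then for every $1\le i\le l$ with $c_\alpha(i)=k-1$ we have $\alpha_i\not\equiv r\pmod 2$. Then $|A_n(M,r)|=|C_n(M,r)|$.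
   Context: A partition of $n$ is a finite non-increasing sequence of positive integers summing to $n$. For a partition $\pi$, the conjugate $\pi'$ has $\pi'_i=\#\{j:\pi_j\ge i\}$; the Durfee square size $d(\pi)$ is the largest $d$ with $\pi_d\ge d$; the successive ranks of $\pi$ are $\pi_i-\pi'_i$ for $1\le i\le d(\pi)$. For $t\ge1$, a $t$-color partition of $n$ is a pair $(\alpha,c_\alpha)$ where $\alpha=(\alpha_1,\dots,\alpha_l)$ is a partition of $n$ and $c_\alpha:\{1,\dots,l\}\to\{1,\dots,t\}$ is a function (the color of the $i$-th part) such that $\alpha_i=\alpha_{i+1}$ implies $c_\alpha(i)\le c_\alpha(i+1)$. *)

theory Defs
  imports Complex_Main "HOL-Number_Theory.Cong" "HOL-Library.FuncSet"
begin

definition is_partition :: "nat list \<Rightarrow> nat \<Rightarrow> bool" where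
  "is_partition p n \<longleftrightarrow> sorted_wrt (\<ge>) p \<and> (\<forall>x \<in> set p. 0 < x) \<and> sum_list p = n"

text \<open>Parts are indexed from 1; the value is meaningful only for \<open>1 \<le> i \<le> length p\<close>.\<close>

definition part :: "nat list \<Rightarrow> nat \<Rightarrow> nat" where
  "part p i = p ! (i - 1)"

definition conj_part :: "nat list \<Rightarrow> nat \<Rightarrow> nat" where
  "conj_part p i = card {j \<in> {1..length p}. part p j \<ge> i}"

text \<open>The empty partition has Durfee square of size 0, hence no successive ranks.\<close>

definition durfee :: "nat list \<Rightarrow> nat" where
  "durfee p = Max (insert 0 {d \<in> {1..length p}. part p d \<ge> d})"

definition succ_rank :: "nat list \<Rightarrow> nat \<Rightarrow> int" where
  "succ_rank p i = int (part p i) - int (conj_part p i)"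

text \<open>
  Colors are the integers \<open>1, \<dots>, t\<close>. For \<open>t = 0\<close> there is no color, so the empty partition
  is the only 0-color partition. Color functions are extensional, so that distinct pairs
  represent distinct \<open>t\<close>-color partitions.
\<close>

definition color_partitions :: "int \<Rightarrow> nat \<Rightarrow> (nat list \<times> (nat \<Rightarrow> int)) set" where
  "color_partitions t n =
     {(\<alpha>, c). is_partition \<alpha> n \<and> c \<in> {1..length \<alpha>} \<rightarrow>\<^sub>E {1..t} \<and>
        (\<forall>i. 1 \<le> i \<and> i < length \<alpha> \<longrightarrow> part \<alpha> i = part \<alpha> (i + 1) \<longrightarrow> c i \<le> c (i + 1))}"

definition rank_set :: "nat \<Rightarrow> int \<Rightarrow> int \<Rightarrow> nat list set" where
  "rank_set n M r =
     {p. is_partition p n \<and> (\<forall>i \<in> {1..durfee p}. succ_rank p i \<in> {- r + 2 .. M - r - 2})}"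

definition size_cond :: "int \<Rightarrow> nat list \<Rightarrow> (nat \<Rightarrow> int) \<Rightarrow> bool" where
  "size_cond r \<alpha> c \<longleftrightarrow>
     (\<forall>i \<in> {1..length \<alpha>}.
        if [int (part \<alpha> i) = r] (mod 2)
        then int (part \<alpha> i) > \<bar>2 * c i - r + 1\<bar>
        else int (part \<alpha> i) > \<bar>2 * c i - r\<bar>)"

definition gap_cond :: "int \<Rightarrow> nat list \<Rightarrow> (nat \<Rightarrow> int) \<Rightarrow> bool" where
  "gap_cond r \<alpha> c \<longleftrightarrow>
     (\<forall>i. 1 \<le> i \<and> i < length \<alpha> \<longrightarrow>
        (let a = int (part \<alpha> i); b = int (part \<alpha> (i + 1)); e = c i - c (i + 1) in
          ([a = b] (mod 2) \<longrightarrow> a - b \<ge> 2 + \<bar>2 * e\<bar>) \<and>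
          (\<not> [a = b] (mod 2) \<and> [b = r] (mod 2) \<longrightarrow> a - b \<ge> 2 + \<bar>2 * e - 1\<bar>) \<and>
          (\<not> [b = a] (mod 2) \<and> [a = r] (mod 2) \<longrightarrow> a - b \<ge> 2 + \<bar>2 * e + 1\<bar>)))"

definition color_set :: "nat \<Rightarrow> int \<Rightarrow> int \<Rightarrow> int \<Rightarrow> (nat list \<times> (nat \<Rightarrow> int)) set" where
  "color_set n M r k =
     {(\<alpha>, c) \<in> color_partitions (k - 1) n.
        size_cond r \<alpha> c \<and> gap_cond r \<alpha> c \<and>
        (even M \<longrightarrow> (\<forall>i \<in> {1..length \<alpha>}. c i = k - 1 \<longrightarrow> \<not> [int (part \<alpha> i) = r] (mod 2)))}"

text \<open>Both sets are finite, so comparing them by \<^const>\<open>card\<close> is meaningful.\<close>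

lemma length_le_sum_list: "\<forall>x \<in> set p. 0 < x \<Longrightarrow> length p \<le> sum_list p" for p :: "nat list"
  by (induction p) (auto simp: Suc_le_eq)

lemma finite_partitions: "finite {p. is_partition p n}"
proof (rule finite_subset)
  show "{p. is_partition p n} \<subseteq> {p. set p \<subseteq> {..n} \<and> length p \<le> n}"
    unfolding is_partition_def using length_le_sum_list member_le_sum_list by fastforce
  show "finite {p. set p \<subseteq> {..n} \<and> length p \<le> n}"
    by (rule finite_lists_length_le) simp
qed

lemma finite_rank_set: "finite (rank_set n M r)"
  by (rule finite_subset[OF _ finite_partitions[of n]]) (auto simp: rank_set_def)

lemma finite_color_set: "finite (color_set n M r k)"
proof (rule finite_subset)
  show "color_set n M r k \<subseteq>
      (SIGMA \<alpha>:{p. is_partition p n}. {1..length \<alpha>} \<rightarrow>\<^sub>E {1..k - 1})"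
    by (auto simp: color_set_def color_partitions_def)
  show "finite (SIGMA \<alpha>:{p. is_partition p n}. {1..length \<alpha>} \<rightarrow>\<^sub>E {1..k - 1})"
    by (intro finite_SigmaI finite_partitions finite_PiE) auto
qed

end

theory Submission
  imports Defs
begin

text \<open>
  Write a partition in Frobenius notation as the list of its pairs (arm, leg) \<open>(a, b)\<close> along the
  diagonal; the successive ranks are the differences \<open>a - b\<close>. Map each pair to the part
  \<open>\<alpha> = a + b + 1\<close> (a diagonal hook length) with colour \<open>c = \<lfloor>(a - b + r) / 2\<rfloor>\<close>. As \<open>\<alpha>\<close> and
  \<open>a - b\<close> have opposite parities, \<open>a - b\<close> is \<open>2c - r + 1\<close> or \<open>2c - r\<close> according to whether
  \<open>\<alpha> \<equiv> r\<close> modulo 2. Hence (i) says \<open>\<alpha> > \<bar>a - b\<bar>\<close>, that is, \<open>a, b \<ge> 0\<close>; (ii) says that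
  arms and legs both decrease strictly; and (iii) with \<open>1 \<le> c \<le> k - 1\<close> bounds the ranks.
\<close>

section \<open>Frobenius symbols\<close>

definition frobenius_symbol :: "(nat \<times> nat) list \<Rightarrow> bool" where
  "frobenius_symbol = sorted_wrt (\<lambda>(a, b) (a', b'). a' < a \<and> b' < b)"

definition frobenius_weight :: "(nat \<times> nat) list \<Rightarrow> nat" where
  "frobenius_weight l = (\<Sum>(a, b)\<leftarrow>l. a + b + 1)"

text \<open>Wraps the Young diagram of \<open>q\<close> in a hook with arm \<open>a\<close> and leg
  \<open>b\<close>, shifting \<open>q\<close> one cell right and down. The first column has length
  \<open>Suc b\<close> only if \<open>length q \<le> b\<close>, since the subtraction
  truncates.\<close>

definition add_hook :: "nat \<Rightarrow> nat \<Rightarrow> nat list \<Rightarrow> nat list" where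
  "add_hook a b q = Suc a # map Suc q @ replicate (b - length q) 1"

fun of_frobenius :: "(nat \<times> nat) list \<Rightarrow> nat list" where
  "of_frobenius [] = []"
| "of_frobenius ((a, b) # l) = add_hook a b (of_frobenius l)"

lemma frobenius_symbol_Nil [simp]: "frobenius_symbol []"
  by (simp add: frobenius_symbol_def)

lemma frobenius_symbol_Cons:
  "frobenius_symbol ((a, b) # l) \<longleftrightarrow> (\<forall>(a', b') \<in> set l. a' < a \<and> b' < b) \<and> frobenius_symbol l"
  by (auto simp: frobenius_symbol_def)

lemma frobenius_symbol_Cons_Cons:
  "frobenius_symbol ((a, b) # (a', b') # l) \<longleftrightarrow> a' < a \<and> b' < b \<and> frobenius_symbol ((a', b') # l)"
  by (force simp: frobenius_symbol_Cons)

lemma frobenius_symbol_iff_nth: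
  "frobenius_symbol l \<longleftrightarrow>
     (\<forall>i. Suc i < length l \<longrightarrow> fst (l ! Suc i) < fst (l ! i) \<and> snd (l ! Suc i) < snd (l ! i))"
proof -
  have "transp (\<lambda>(a, b) (a', b'). (a' :: nat) < a \<and> (b' :: nat) < b)"
    by (auto simp: transp_def)
  from sorted_wrt_iff_nth_Suc_transp[OF this] show ?thesis
    by (simp add: frobenius_symbol_def case_prod_beta)
qed

text \<open>By induction the inner diagram has \<open>Suc b' \<le> b\<close> rows, so the
  subtraction in \<open>add_hook\<close> does not truncate.\<close>

lemma length_of_frobenius_Cons:
  "frobenius_symbol ((a, b) # l) \<Longrightarrow> length (of_frobenius ((a, b) # l)) = Suc b"
proof (induction l arbitrary: a b)
  case (Cons x l)
  obtain a' b' where x: "x = (a', b')" by fastforce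
  have "b' < b" "length (of_frobenius (x # l)) = Suc b'"
    using Cons by (auto simp: x frobenius_symbol_Cons_Cons)
  then show ?case
    by (simp add: add_hook_def[of a b])
qed (simp add: add_hook_def)

lemma length_of_frobenius_le:
  "frobenius_symbol ((a, b) # l) \<Longrightarrow> length (of_frobenius l) \<le> b"
  using length_of_frobenius_Cons[of a b l] by (simp add: add_hook_def)

lemma sorted_wrt_replicate: "R x x \<Longrightarrow> sorted_wrt R (replicate n x)"
  by (induction n) auto

lemma is_partition_add_hook:
  assumes "is_partition q n" "length q \<le> b" "\<forall>x \<in> set q. x \<le> a"
  shows "is_partition (add_hook a b q) (a + b + 1 + n)"
  using assms sum_list_Suc[of "\<lambda>x. x" q]
  by (auto simp: is_partition_def add_hook_def sorted_wrt_append sorted_wrt_replicate sorted_wrt_map sum_list_replicate)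

text \<open>The second conjunct strengthens the induction: the new first row stays the longest
  because the inner parts are at most the new arm.\<close>

lemma is_partition_of_frobenius_aux:
  "frobenius_symbol l \<Longrightarrow> is_partition (of_frobenius l) (frobenius_weight l) \<and>
     (\<forall>a. (\<forall>(a', b') \<in> set l. a' < a) \<longrightarrow> (\<forall>x \<in> set (of_frobenius l). x \<le> a))"
proof (induction l)
  case Nil
  then show ?case by (simp add: is_partition_def frobenius_weight_def)
next
  case (Cons x l)
  obtain a b where x: "x = (a, b)" by fastforce
  have s: "frobenius_symbol l" "\<forall>(a', b') \<in> set l. a' < a"
    using Cons.prems by (auto simp: x frobenius_symbol_Cons)
  have le: "\<forall>y \<in> set (of_frobenius l). y \<le> a"
    using Cons.IH[OF s(1)] s(2) by blast
  have "is_partition (of_frobenius (x # l)) (frobenius_weight (x # l))"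
    using is_partition_add_hook[OF _ length_of_frobenius_le le, of "frobenius_weight l"]
      Cons.IH[OF s(1)] Cons.prems by (simp add: x frobenius_weight_def)
  then show ?case
    using le by (auto simp: x add_hook_def)
qed

lemma is_partition_of_frobenius:
  "frobenius_symbol l \<Longrightarrow> is_partition (of_frobenius l) (frobenius_weight l)"
  using is_partition_of_frobenius_aux by blast

section \<open>Recovering a Frobenius symbol from its partition\<close>

lemma filter_map_Suc_pos:
  "\<forall>x \<in> set q. 0 < x \<Longrightarrow> filter (\<lambda>x. 1 < x) (map Suc q @ replicate m 1) = map Suc q"
  by (induction q) auto

text \<open>The outermost hook can be read off and removed: the first part gives the arm, the length
  gives the leg, and the parts after the first that exceed 1, lowered by 1, form the inner
  partition.\<close>

lemma inj_on_of_frobenius: "inj_on of_frobenius (Collect frobenius_symbol)"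
proof -
  have "of_frobenius l = of_frobenius l' \<Longrightarrow> frobenius_symbol l \<Longrightarrow> frobenius_symbol l' \<Longrightarrow> l = l'"
    for l l'
  proof (induction l arbitrary: l')
    case Nil
    then show ?case by (cases l') (auto simp: add_hook_def)
  next
    case (Cons x l)
    obtain a b where x: "x = (a, b)" by fastforce
    obtain a' b' m where l': "l' = (a', b') # m"
      using Cons.prems(1) by (cases l') (auto simp: x add_hook_def)
    have s: "frobenius_symbol l" "frobenius_symbol m"
      using Cons.prems by (auto simp: x l' frobenius_symbol_Cons)
    have "b = b'"
      using length_of_frobenius_Cons[of a b l] length_of_frobenius_Cons[of a' b' m] Cons.prems
      by (simp add: x l')
    have pos: "\<forall>x \<in> set (of_frobenius l). 0 < x" "\<forall>x \<in> set (of_frobenius m). 0 < x"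
      using s is_partition_of_frobenius by (auto simp: is_partition_def)
    have eq: "a = a'"
      "map Suc (of_frobenius l) @ replicate (b - length (of_frobenius l)) 1
        = map Suc (of_frobenius m) @ replicate (b' - length (of_frobenius m)) 1"
      using Cons.prems(1) by (simp_all add: x l' add_hook_def)
    have "map Suc (of_frobenius l) = map Suc (of_frobenius m)"
      using arg_cong[OF eq(2), of "filter (\<lambda>x. 1 < x)"]
      by (simp only: filter_map_Suc_pos[OF pos(1)] filter_map_Suc_pos[OF pos(2)])
    then have "of_frobenius l = of_frobenius m"
      by (metis inj_Suc map_injective)
    then show ?case
      using Cons.IH s \<open>a = a'\<close> \<open>b = b'\<close> by (simp add: x l')
  qed
  then show ?thesis by (auto simp: inj_on_def)
qed

lemma decreasing_eq_filter_append_ones: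
  fixes p :: "nat list"
  assumes "sorted_wrt (\<ge>) p" "\<forall>x \<in> set p. 0 < x"
  shows "p = filter (\<lambda>x. 1 < x) p @ replicate (length p - length (filter (\<lambda>x. 1 < x) p)) 1"
  using assms
proof (induction p)
  case (Cons x p)
  show ?case
  proof (cases "1 < x")
    case True
    then show ?thesis using Cons by simp
  next
    case False
    then have "\<forall>y \<in> set (x # p). y = 1"
      using Cons.prems by force
    then show ?thesis
      by (metis append_Nil diff_zero filter_False less_irrefl list.size(3) replicate_length_same)
  qed
qed simp

text \<open>Deleting the first row and first column leaves a partition \<open>q\<close> with fewer
  parts, so induction on the length applies.\<close>

lemma ex_of_frobenius:
  assumes "is_partition p n"
  shows "\<exists>l. frobenius_symbol l \<and> of_frobenius l = p"
  using assms
proof (induction p arbitrary: n rule: length_induct)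
  case (1 p)
  show ?case
  proof (cases p)
    case Nil
    then show ?thesis by (intro exI[of _ "[]"]) simp
  next
    case (Cons x xs)
    define f where "f = filter (\<lambda>x. 1 < x) xs"
    define q where "q = map (\<lambda>y. y - 1) f"
    have p: "sorted_wrt (\<ge>) xs" "\<forall>y \<in> set xs. 0 < y" "\<forall>y \<in> set xs. y \<le> x" "0 < x"
      using "1.prems" by (auto simp: Cons is_partition_def)
    have f: "\<forall>y \<in> set f. 1 < y \<and> y \<le> x" "sorted_wrt (\<ge>) f"
      using p by (auto simp: f_def sorted_wrt_filter)
    have fq: "map Suc q = f"
      using f(1) by (auto simp: q_def intro!: map_idI)
    have "length q \<le> length xs" by (simp add: q_def f_def)
    have "is_partition q (sum_list q)"
      using f sorted_wrt_mono_rel[OF _ f(2), of "\<lambda>x y. y - 1 \<le> x - 1"]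
      by (auto simp: is_partition_def q_def sorted_wrt_map)
    then obtain l where l: "frobenius_symbol l" "of_frobenius l = q"
      using "1.IH" \<open>length q \<le> length xs\<close> by (metis Cons le_imp_less_Suc length_Cons)
    \<comment> \<open>Only the first pair (a, b) of \<open>l\<close> has to be compared. Its leg
      satisfies \<open>Suc b = length q\<close>; its arm gives the part \<open>Suc a\<close> of
      \<open>q\<close>, hence \<open>Suc (Suc a) \<le> x\<close>.\<close>
    have "frobenius_symbol ((x - 1, length xs) # l)"
    proof (cases l)
      case (Cons y m)
      obtain a b where y: "y = (a, b)" by fastforce
      have "Suc b = length q"
        using length_of_frobenius_Cons[of a b m] l by (simp add: Cons y)
      moreover have "Suc a \<in> set q"
        using l(2) by (auto simp: Cons y add_hook_def)
      then have "Suc (Suc a) \<in> set f"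
        by (auto simp flip: fq)
      ultimately show ?thesis
        using f l(1) \<open>length q \<le> length xs\<close> by (fastforce simp: Cons y frobenius_symbol_Cons_Cons)
    qed (simp add: frobenius_symbol_Cons)
    moreover have "of_frobenius ((x - 1, length xs) # l) = p"
      using decreasing_eq_filter_append_ones[OF p(1,2), folded f_def, symmetric] \<open>0 < x\<close>
      by (simp add: l(2) add_hook_def fq Cons flip: length_map[of Suc q])
    ultimately show ?thesis by blast
  qed
qed

section \<open>Successive ranks\<close>

lemma part_add_hook_Suc: "1 \<le> i \<Longrightarrow> i \<le> length q \<Longrightarrow> part (add_hook a b q) (Suc i) = Suc (part q i)"
  by (cases i) (auto simp: part_def add_hook_def nth_append)

lemma part_add_hook_beyond: "length q < i \<Longrightarrow> i \<le> b \<Longrightarrow> part (add_hook a b q) (Suc i) = 1"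
  by (cases i) (auto simp: part_def add_hook_def nth_append)

lemma length_add_hook: "length q \<le> b \<Longrightarrow> length (add_hook a b q) = Suc b"
  by (simp add: add_hook_def)

lemma atLeast1_atMost_Suc: "{1..Suc n} = insert 1 (Suc ` {1..n})"
  by (simp add: image_Suc_atLeastAtMost atLeastAtMost_insertL)

lemma ball_atLeast1_atMost_Suc: "(\<forall>i \<in> {1..Suc n}. Q i) \<longleftrightarrow> Q 1 \<and> (\<forall>i \<in> {1..n}. Q (Suc i))"
  unfolding atLeast1_atMost_Suc by blast

text \<open>Column i + 1 gains one cell from the new first row, which reaches it because i \<le> a.
  The appended rows of size 1 do not reach it.\<close>

lemma conj_part_add_hook_Suc:
  assumes "length q \<le> b" "1 \<le> i" "i \<le> a"
  shows "conj_part (add_hook a b q) (Suc i) = Suc (conj_part q i)"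
proof -
  have "{j \<in> {1..Suc b}. Suc i \<le> part (add_hook a b q) j}
      = insert 1 (Suc ` {j \<in> {1..length q}. i \<le> part q j})" (is "?L = ?R")
  proof -
    have "part (add_hook a b q) 1 = Suc a"
      by (simp add: part_def add_hook_def)
    moreover have "Suc i \<le> part (add_hook a b q) (Suc j) \<longleftrightarrow> j \<le> length q \<and> i \<le> part q j"
      if "j \<in> {1..b}" for j
      using part_add_hook_Suc[of j q a b] part_add_hook_beyond[of q j b a] that assms
      by (cases "j \<le> length q") auto
    ultimately show ?thesis
      unfolding atLeast1_atMost_Suc using assms by fastforce
  qed
  moreover have "finite {j \<in> {1..length q}. i \<le> part q j}"
    by (rule finite_subset[of _ "{1..length q}"]) auto
  ultimately show ?thesis
    unfolding conj_part_def length_add_hook[OF assms(1)]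
    by (simp only:) (subst card_insert_disjoint, auto simp: card_image)
qed

lemma conj_part_1:
  assumes "is_partition p n"
  shows "conj_part p 1 = length p"
proof -
  have "{j \<in> {1..length p}. 1 \<le> part p j} = {1..length p}"
    using assms by (fastforce simp: is_partition_def part_def Suc_le_eq)
  then show ?thesis by (simp add: conj_part_def)
qed

text \<open>The diagonal of \<open>q\<close> moves one step down and right, and the corner of the
  hook is a new diagonal cell.\<close>

lemma durfee_add_hook:
  assumes "length q \<le> b"
  shows "durfee (add_hook a b q) = Suc (durfee q)"
proof -
  let ?S = "\<lambda>p. insert 0 {d \<in> {1..length p}. d \<le> part p d}"
  have "part (add_hook a b q) 1 = Suc a"
    by (simp add: part_def add_hook_def)
  moreover have "Suc d \<le> part (add_hook a b q) (Suc d) \<longleftrightarrow> d \<le> length q \<and> d \<le> part q d"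
    if "d \<in> {1..b}" for d
    using part_add_hook_Suc[of d q a b] part_add_hook_beyond[of q d b a] that assms
    by (cases "d \<le> length q") auto
  \<comment> \<open>The default 0 in the set for \<open>q\<close> becomes \<open>Suc 0\<close> in
    the image and accounts for the new corner.\<close>
  ultimately have "?S (add_hook a b q) = insert 0 (Suc ` ?S q)"
    unfolding length_add_hook[OF assms] atLeast1_atMost_Suc using assms by fastforce
  then have "durfee (add_hook a b q) = Max (insert 0 (Suc ` ?S q))"
    by (simp only: durfee_def)
  also have "\<dots> = Max (Suc ` ?S q)"
    by (subst Max_insert) auto
  also have "\<dots> = Suc (durfee q)"
    unfolding durfee_def by (rule mono_Max_commute[symmetric]) (auto simp: mono_Suc)
  finally show ?thesis .
qed

text \<open>With the next lemma, this places every diagonal index of \<open>q\<close> within the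
  ranges required by \<open>part_add_hook_Suc\<close> and
  \<open>conj_part_add_hook_Suc\<close>.\<close>

lemma durfee_le_length: "durfee p \<le> length p"
  unfolding durfee_def by (subst Max_le_iff) auto

lemma durfee_le_part_1:
  assumes "is_partition p n" "\<forall>x \<in> set p. x \<le> a"
  shows "durfee p \<le> a"
  unfolding durfee_def
proof (subst Max_le_iff; safe?)
  fix d assume d: "d \<in> {1..length p}" "d \<le> part p d"
  have "part p d \<in> set p"
    using d by (auto simp: part_def)
  then show "d \<le> a" using assms d by fastforce
qed auto

text \<open>The hook has first rank (a + 1) - (b + 1). It lengthens each diagonal row and column of
  \<open>q\<close> by 1, so the ranks of \<open>q\<close> reappear with indices shifted by
  one.\<close>

lemma ranks_of_frobenius:
  "frobenius_symbol l \<Longrightarrow>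
     (\<forall>i \<in> {1..durfee (of_frobenius l)}. P (succ_rank (of_frobenius l) i))
       \<longleftrightarrow> (\<forall>(a, b) \<in> set l. P (int a - int b))"
proof (induction l)
  case Nil
  then show ?case by (simp add: durfee_def)
next
  case (Cons x l)
  obtain a b where x: "x = (a, b)" by fastforce
  define q where "q = of_frobenius l"
  have s: "frobenius_symbol l" "\<forall>(a', b') \<in> set l. a' < a"
    using Cons.prems by (auto simp: x frobenius_symbol_Cons)
  have lq: "length q \<le> b"
    using length_of_frobenius_le Cons.prems by (auto simp: x q_def)
  have q: "is_partition q (frobenius_weight l)" "\<forall>y \<in> set q. y \<le> a"
    using is_partition_of_frobenius_aux[OF s(1)] s(2) by (auto simp: q_def)
  have "succ_rank (add_hook a b q) 1 = int a - int b"
    using conj_part_1[OF is_partition_add_hook[OF q(1) lq q(2)]] length_add_hook[OF lq]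
    by (simp add: succ_rank_def) (simp add: part_def add_hook_def)
  moreover have "succ_rank (add_hook a b q) (Suc i) = succ_rank q i" if "i \<in> {1..durfee q}" for i
    using that durfee_le_length[of q] durfee_le_part_1[OF q] lq
    by (simp add: succ_rank_def part_add_hook_Suc conj_part_add_hook_Suc)
  ultimately show ?case
    using Cons.IH[OF s(1)]
    by (simp add: x durfee_add_hook lq ball_atLeast1_atMost_Suc[simplified] flip: q_def)
qed

section \<open>Colour partitions\<close>

definition frobenius_set :: "nat \<Rightarrow> int \<Rightarrow> int \<Rightarrow> (nat \<times> nat) list set" where
  "frobenius_set n M r = {l. frobenius_symbol l \<and> frobenius_weight l = n \<and>
     (\<forall>(a, b) \<in> set l. int a - int b \<in> {- r + 2 .. M - r - 2})}"

lemma bij_betw_of_frobenius: "bij_betw of_frobenius (frobenius_set n M r) (rank_set n M r)"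
proof (rule bij_betw_imageI)
  show "inj_on of_frobenius (frobenius_set n M r)"
    by (rule inj_on_subset[OF inj_on_of_frobenius]) (auto simp: frobenius_set_def)
  have "of_frobenius l \<in> rank_set n M r \<longleftrightarrow> l \<in> frobenius_set n M r" if "frobenius_symbol l" for l
    using is_partition_of_frobenius[OF that]
      ranks_of_frobenius[OF that, of "\<lambda>x. x \<in> {- r + 2 .. M - r - 2}"] that
    by (auto simp: rank_set_def frobenius_set_def is_partition_def)
  moreover have "\<exists>l. frobenius_symbol l \<and> of_frobenius l = p" if "p \<in> rank_set n M r" for p
    using that ex_of_frobenius by (auto simp: rank_set_def)
  ultimately show "of_frobenius ` frobenius_set n M r = rank_set n M r"
    by (fastforce simp: frobenius_set_def)
qed

text \<open>The rank \<open>a - b\<close> recovered from a part and its colour.\<close>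

definition color_rank :: "int \<Rightarrow> nat \<Rightarrow> int \<Rightarrow> int" where
  "color_rank r \<alpha> c = (if [int \<alpha> = r] (mod 2) then 2 * c - r + 1 else 2 * c - r)"

text \<open>The restricted lambda makes the colour function extensional, as
  \<open>color_partitions\<close> demands; \<open>i - 1\<close> turns the index of a part into a
  list position.\<close>

definition coloring :: "int \<Rightarrow> (nat \<times> nat) list \<Rightarrow> nat list \<times> (nat \<Rightarrow> int)" where
  "coloring r l = (map (\<lambda>(a, b). a + b + 1) l,
     \<lambda>i \<in> {1..length l}. (int (fst (l ! (i - 1))) - int (snd (l ! (i - 1))) + r) div 2)"

text \<open>If a + b + 1 is congruent to r modulo 2, then a - b + r is odd and \<open>div\<close>
  rounds down; the \<open>+ 1\<close> in \<open>color_rank\<close> undoes this rounding.\<close>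

lemma color_rank_eq_iff:
  "color_rank r (a + b + 1) c = int a - int b \<longleftrightarrow> c = (int a - int b + r) div 2"
  unfolding color_rank_def cong_def by (auto split: if_splits) presburger+

lemma color_rank_coloring:
  assumes "coloring r l = (\<alpha>, c)" "1 \<le> i" "i \<le> length l"
  shows "color_rank r (part \<alpha> i) (c i) = int (fst (l ! (i - 1))) - int (snd (l ! (i - 1)))"
    and "part \<alpha> i = fst (l ! (i - 1)) + snd (l ! (i - 1)) + 1"
proof -
  show p: "part \<alpha> i = fst (l ! (i - 1)) + snd (l ! (i - 1)) + 1"
    using assms by (auto simp: coloring_def part_def case_prod_beta)
  show "color_rank r (part \<alpha> i) (c i) = int (fst (l ! (i - 1))) - int (snd (l ! (i - 1)))"
    unfolding p color_rank_eq_iff using assms by (auto simp: coloring_def)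
qed

section \<open>Size and gap conditions in terms of ranks\<close>

lemma size_cond_iff:
  "size_cond r \<alpha> c \<longleftrightarrow> (\<forall>i \<in> {1..length \<alpha>}. \<bar>color_rank r (part \<alpha> i) (c i)\<bar> < int (part \<alpha> i))"
  unfolding size_cond_def color_rank_def by (intro ball_cong refl) auto

text \<open>The difference of the two ranks is 2e, 2e - 1 or 2e + 1 in the three parity cases of
  \<open>gap_cond\<close>, so these merge into one inequality.\<close>

lemma gap_cond_iff:
  "gap_cond r \<alpha> c \<longleftrightarrow> (\<forall>i. 1 \<le> i \<and> i < length \<alpha> \<longrightarrow>
     2 + \<bar>color_rank r (part \<alpha> i) (c i) - color_rank r (part \<alpha> (i + 1)) (c (i + 1))\<bar>
       \<le> int (part \<alpha> i) - int (part \<alpha> (i + 1)))"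
proof -
  have *: "(let e = c - d in
          ([a = b] (mod 2) \<longrightarrow> a - b \<ge> 2 + \<bar>2 * e\<bar>) \<and>
          (\<not> [a = b] (mod 2) \<and> [b = r] (mod 2) \<longrightarrow> a - b \<ge> 2 + \<bar>2 * e - 1\<bar>) \<and>
          (\<not> [b = a] (mod 2) \<and> [a = r] (mod 2) \<longrightarrow> a - b \<ge> 2 + \<bar>2 * e + 1\<bar>))
      \<longleftrightarrow> 2 + \<bar>(if [a = r] (mod 2) then 2 * c - r + 1 else 2 * c - r)
            - (if [b = r] (mod 2) then 2 * d - r + 1 else 2 * d - r)\<bar> \<le> a - b" for a b c d :: int
  proof -
    have "x mod 2 = 0 \<or> x mod 2 = 1" for x :: int by presburger
    from this[of a] this[of b] this[of r] show ?thesis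
      unfolding cong_def Let_def by (elim disjE) auto
  qed
  then show ?thesis
    unfolding gap_cond_def color_rank_def by (simp only: Let_def *[unfolded Let_def])
qed

section \<open>Bijectivity of the colouring map\<close>

lemma inj_coloring: "inj (coloring r)"
proof (rule injI)
  fix l l' assume eq: "coloring r l = coloring r l'"
  obtain \<alpha> c where c: "coloring r l = (\<alpha>, c)" by fastforce
  have c': "coloring r l' = (\<alpha>, c)" using eq c by simp
  have len: "length l = length l'"
    using eq by (auto simp: coloring_def dest: map_eq_imp_length_eq)
  show "l = l'"
  proof (rule nth_equalityI[OF len])
    fix i assume "i < length l"
    \<comment> \<open>The part fixes the sum of arm and leg and the colour rank fixes their
      difference, which determines the pair.\<close>
    then show "l ! i = l' ! i"
      using color_rank_coloring[OF c, of "Suc i"] color_rank_coloring[OF c', of "Suc i"] len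
      by (simp add: prod_eq_iff)
  qed
qed

lemma ex_coloring:
  assumes "size_cond r \<alpha> c" "c \<in> extensional {1..length \<alpha>}"
  shows "\<exists>l. coloring r l = (\<alpha>, c)"
proof -
  define x where "x i = color_rank r (\<alpha> ! i) (c (Suc i))" for i
  \<comment> \<open>\<open>a\<close> and \<open>b\<close> solve a + b + 1 = \<alpha> and a - b =
    x.\<close>
  define a where "a i = nat ((int (\<alpha> ! i) - 1 + x i) div 2)" for i
  define b where "b i = nat ((int (\<alpha> ! i) - 1 - x i) div 2)" for i
  define l where "l = map (\<lambda>i. (a i, b i)) [0..<length \<alpha>]"
  have ab: "\<alpha> ! i = a i + b i + 1 \<and> x i = int (a i) - int (b i)" if "i < length \<alpha>" for i
  proof -
    have "\<bar>x i\<bar> < int (\<alpha> ! i)"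
      using bspec[OF assms(1)[unfolded size_cond_iff], of "Suc i"] that by (simp add: x_def part_def)
    \<comment> \<open>This parity makes both halvings exact. The bound on \<open>x i\<close> then
      gives 0 \<le> t and t \<le> \<alpha> - 1, so \<open>nat\<close> changes neither value.\<close>
    moreover have "odd (int (\<alpha> ! i) + x i)"
      unfolding x_def color_rank_def cong_def by presburger
    then obtain t where "int (\<alpha> ! i) + x i = 2 * t + 1"
      by (elim oddE)
    moreover from this have "(int (\<alpha> ! i) - 1 + x i) div 2 = t"
      "(int (\<alpha> ! i) - 1 - x i) div 2 = int (\<alpha> ! i) - 1 - t"
      by presburger+
    then have "a i = nat t" "b i = nat (int (\<alpha> ! i) - 1 - t)"
      by (simp_all only: a_def b_def)
    ultimately show ?thesis by linarith
  qed
  have "map (\<lambda>(a, b). a + b + 1) l = \<alpha>"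
    using ab by (intro nth_equalityI) (auto simp: l_def)
  moreover have "(\<lambda>i \<in> {1..length l}. (int (fst (l ! (i - 1))) - int (snd (l ! (i - 1))) + r) div 2) = c"
  proof (rule extensionalityI[OF _ assms(2)])
    fix i assume i: "i \<in> {1..length \<alpha>}"
    then obtain j where j: "i = Suc j" "j < length \<alpha>" by (cases i) auto
    have "c i = (int (a j) - int (b j) + r) div 2"
      using ab[OF j(2)] color_rank_eq_iff[of r "a j" "b j" "c i"] unfolding x_def j(1) by metis
    then show "(\<lambda>i \<in> {1..length l}. (int (fst (l ! (i - 1))) - int (snd (l ! (i - 1))) + r) div 2) i = c i"
      using j by (simp add: l_def)
  qed (simp add: l_def)
  ultimately show ?thesis by (auto simp: coloring_def)
qed

text \<open>Since x is 2c - r or 2c - r + 1, the lower bound always means c \<ge> 1. The upper bound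
  means c \<le> k - 1, except that for M = 2k and a part congruent to r it reads 2c + 1 \<le> 2k -
  2, that is c \<le> k - 2; the condition for even M excludes exactly the colour k - 1
  there.\<close>

lemma color_range_iff:
  fixes M :: int
  assumes "k = M div 2" "color_rank r \<alpha> c = x"
  shows "c \<in> {1..k - 1} \<and> (even M \<longrightarrow> c = k - 1 \<longrightarrow> \<not> [int \<alpha> = r] (mod 2))
     \<longleftrightarrow> x \<in> {- r + 2 .. M - r - 2}"
  using assms unfolding color_rank_def
  by (cases "even M"; cases "[int \<alpha> = r] (mod 2)") (auto elim!: evenE oddE)

lemma coloring_in_color_set_iff:
  assumes "k = M div 2"
  shows "coloring r l \<in> color_set n M r k \<longleftrightarrow> l \<in> frobenius_set n M r"
proof -
  obtain \<alpha> c where ac: "coloring r l = (\<alpha>, c)" by fastforce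
  have len: "length \<alpha> = length l" and ext: "c \<in> extensional {1..length \<alpha>}"
    and \<alpha>: "\<alpha> = map (\<lambda>(a, b). a + b + 1) l"
    using ac by (auto simp: coloring_def)
  note cr = color_rank_coloring[OF ac]
  \<comment> \<open>The inequality \<bar>a - b\<bar> < a + b + 1 holds for all natural numbers a and
    b.\<close>
  have size: "size_cond r \<alpha> c"
    using cr by (auto simp: size_cond_iff len)
  \<comment> \<open>For consecutive pairs (a, b) and (a', b'), the two signs of the absolute value
    give 2(a - a') \<ge> 2 and 2(b - b') \<ge> 2.\<close>
  have gap: "gap_cond r \<alpha> c \<longleftrightarrow> frobenius_symbol l"
  proof -
    have "gap_cond r \<alpha> c \<longleftrightarrow> (\<forall>i. 1 \<le> Suc i \<and> Suc i < length l \<longrightarrow>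
       2 + \<bar>color_rank r (part \<alpha> (Suc i)) (c (Suc i)) - color_rank r (part \<alpha> (Suc i + 1)) (c (Suc i + 1))\<bar>
       \<le> int (part \<alpha> (Suc i)) - int (part \<alpha> (Suc i + 1)))"
      unfolding gap_cond_iff len by (metis One_nat_def Suc_le_D)
    also have "\<dots> \<longleftrightarrow> frobenius_symbol l"
      unfolding frobenius_symbol_iff_nth
    proof (intro iff_allI)
      fix i
      show "(1 \<le> Suc i \<and> Suc i < length l \<longrightarrow>
       2 + \<bar>color_rank r (part \<alpha> (Suc i)) (c (Suc i)) - color_rank r (part \<alpha> (Suc i + 1)) (c (Suc i + 1))\<bar>
       \<le> int (part \<alpha> (Suc i)) - int (part \<alpha> (Suc i + 1)))
       \<longleftrightarrow> (Suc i < length l \<longrightarrow> fst (l ! Suc i) < fst (l ! i) \<and> snd (l ! Suc i) < snd (l ! i))"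
        using cr[of "Suc i"] cr[of "Suc (Suc i)"] by auto
    qed
    finally show ?thesis .
  qed
  have range: "(\<forall>i \<in> {1..length \<alpha>}. c i \<in> {1..k - 1}
      \<and> (even M \<longrightarrow> c i = k - 1 \<longrightarrow> \<not> [int (part \<alpha> i) = r] (mod 2)))
    \<longleftrightarrow> (\<forall>(a, b) \<in> set l. int a - int b \<in> {- r + 2 .. M - r - 2})"
  proof -
    have "(\<forall>i \<in> {1..length \<alpha>}. c i \<in> {1..k - 1}
        \<and> (even M \<longrightarrow> c i = k - 1 \<longrightarrow> \<not> [int (part \<alpha> i) = r] (mod 2)))
      \<longleftrightarrow> (\<forall>i \<in> Suc ` {..<length l}.
         int (fst (l ! (i - 1))) - int (snd (l ! (i - 1))) \<in> {- r + 2 .. M - r - 2})"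
    proof (intro ball_cong)
      show "{1..length \<alpha>} = Suc ` {..<length l}"
        by (simp add: len lessThan_atLeast0 atLeastLessThanSuc_atLeastAtMost)
      fix i assume "i \<in> Suc ` {..<length l}"
      then have "1 \<le> i" "i \<le> length l" by auto
      then show "(c i \<in> {1..k - 1} \<and> (even M \<longrightarrow> c i = k - 1 \<longrightarrow> \<not> [int (part \<alpha> i) = r] (mod 2)))
        \<longleftrightarrow> int (fst (l ! (i - 1))) - int (snd (l ! (i - 1))) \<in> {- r + 2 .. M - r - 2}"
        by (intro color_range_iff assms cr(1))
    qed
    then show ?thesis by (auto simp: all_set_conv_all_nth case_prod_beta)
  qed
  have partition: "is_partition \<alpha> n \<longleftrightarrow> frobenius_weight l = n" if "frobenius_symbol l"
  proof -
    have "sorted_wrt (\<ge>) \<alpha>"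
      unfolding \<alpha> sorted_wrt_map
      by (rule sorted_wrt_mono_rel[OF _ that[unfolded frobenius_symbol_def]]) auto
    then show ?thesis
      by (auto simp: is_partition_def \<alpha> frobenius_weight_def)
  qed
  \<comment> \<open>Consecutive parts differ by at least 2, so the colour ordering that
    \<open>color_partitions\<close> imposes on equal parts holds.\<close>
  have distinct: "part \<alpha> i \<noteq> part \<alpha> (i + 1)" if "gap_cond r \<alpha> c" "1 \<le> i" "i < length \<alpha>" for i
    using that unfolding gap_cond_iff by fastforce
  have "c \<in> {1..length \<alpha>} \<rightarrow>\<^sub>E {1..k - 1} \<longleftrightarrow> (\<forall>i \<in> {1..length \<alpha>}. c i \<in> {1..k - 1})"
    using ext by (simp add: PiE_iff)
  then have "coloring r l \<in> color_set n M r k \<longleftrightarrow> is_partition \<alpha> n \<and> gap_cond r \<alpha> c \<and>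
      (\<forall>i \<in> {1..length \<alpha>}. c i \<in> {1..k - 1}
        \<and> (even M \<longrightarrow> c i = k - 1 \<longrightarrow> \<not> [int (part \<alpha> i) = r] (mod 2)))"
    unfolding ac color_set_def color_partitions_def mem_Collect_eq prod.case
    using size distinct by blast
  then show ?thesis
    unfolding range gap frobenius_set_def using partition by blast
qed

text \<open>\<open>ex_coloring\<close> supplies a preimage under \<open>coloring\<close>, and
  \<open>coloring_in_color_set_iff\<close> places it in \<open>frobenius_set\<close>.\<close>

lemma bij_betw_coloring:
  assumes "k = M div 2"
  shows "bij_betw (coloring r) (frobenius_set n M r) (color_set n M r k)"
proof (rule bij_betw_imageI)
  show "inj_on (coloring r) (frobenius_set n M r)"
    by (rule inj_on_subset[OF inj_coloring]) simp
  have "\<exists>l. coloring r l = z" if "z \<in> color_set n M r k" for z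
    using that ex_coloring by (fastforce simp: color_set_def color_partitions_def PiE_def)
  then show "coloring r ` frobenius_set n M r = color_set n M r k"
    using coloring_in_color_set_iff[OF assms] by blast
qed

theorem theorem3:
  fixes r M k :: int and n :: nat
  assumes "0 < r" and "real_of_int r \<le> real_of_int M / 2" and "k = \<lfloor>real_of_int M / 2\<rfloor>"
  shows "card (rank_set n M r) = card (color_set n M r k)"
proof -
  have "k = M div 2"
    using assms(3) floor_divide_of_int_eq[of M 2, where 'a = real] by simp
  then show ?thesis
    using bij_betw_same_card[OF bij_betw_of_frobenius] bij_betw_same_card[OF bij_betw_coloring]
    by metis
qed

end
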